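(* There exists a universal constant $c>0$ such that the following holds. Let $d\geq 1$ and let $K\subset\mathbb{R}^d$ be a nonempty compact set. Suppose that for every $x\in K$ $$\liminf_{r\to 0}\frac{\int_r^{\operatorname{diam}K}d_K^2(x,t)\,\frac{dt}{t}}{-\log r}>0 .$$ Then $\dim_H(K)>0$. If additionally there is a constant $d_0>0$ such that for every $x\in K$ $$\liminf_{r\to 0}\frac{\int_r^{\operatorname{diam}K}d_K^2(x,t)\,\frac{dt}{t}}{-\log r}\geq d_0^2,$$ then $\dim_H(K)\geq c\,d_0^2$.
   Context: $\dim_H$ is the Hausdorff dimension. For $K\subset\mathbb{R}^d$, $x\in K$ and $r>0$, the convex density of $K$ at $x$ at scale $r$ is $$d_K(x,r)=\frac{I(x,r)}{2r},$$ where $I(x,r)$ is the diameter of the convex hull of $K\cap B(x,r)$, and $B(x,r)$ is the ball of center $x$ and radius $r$. *)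

theory Defs
  imports "HOL-Analysis.Analysis"
begin

text \<open>
  A constant that is uniform in the dimension \<open>d\<close> cannot be stated with \<open>real ^ 'n\<close>,
  since types are not quantified inside a formula. We therefore realise all the spaces
  \<open>\<real>\<^sup>d\<close> as subspaces of the inner product space of finitely supported real sequences
  with the usual inner product \<open>\<Sum>i. x i * y i\<close>.
\<close>

typedef finseq = "{f :: nat \<Rightarrow> real. finite {i. f i \<noteq> 0}}"
  morphisms coord Abs_finseq
  by (rule exI[of _ "\<lambda>_. 0"]) simp

lemma finite_coord: "finite {i. coord x i \<noteq> 0}"
  using coord[of x] by simp

lemma coord_Abs: "finite {i. f i \<noteq> 0} \<Longrightarrow> coord (Abs_finseq f) = f"
  by (simp add: Abs_finseq_inverse)

lemma finseq_eqI: "(\<And>i. coord x i = coord y i) \<Longrightarrow> x = y"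
  by (metis coord_inject ext)

instantiation finseq :: real_vector
begin

definition "0 = Abs_finseq (\<lambda>_. 0)"
definition "x + y = Abs_finseq (\<lambda>i. coord x i + coord y i)"
definition "x - y = Abs_finseq (\<lambda>i. coord x i - coord y i)"
definition "- x = Abs_finseq (\<lambda>i. - coord x i)"
definition "scaleR a x = Abs_finseq (\<lambda>i. a * coord x i)"

lemma coord_zero [simp]: "coord 0 i = 0"
  by (simp add: zero_finseq_def coord_Abs)

lemma coord_add [simp]: "coord (x + y) i = coord x i + coord y i"
proof -
  have "finite {i. coord x i + coord y i \<noteq> 0}"
    by (rule finite_subset[of _ "{i. coord x i \<noteq> 0} \<union> {i. coord y i \<noteq> 0}"])
       (auto simp: finite_coord)
  then show ?thesis
    by (simp add: plus_finseq_def coord_Abs)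
qed

lemma coord_diff [simp]: "coord (x - y) i = coord x i - coord y i"
proof -
  have "finite {i. coord x i - coord y i \<noteq> 0}"
    by (rule finite_subset[of _ "{i. coord x i \<noteq> 0} \<union> {i. coord y i \<noteq> 0}"])
       (auto simp: finite_coord)
  then show ?thesis
    by (simp add: minus_finseq_def coord_Abs)
qed

lemma coord_uminus [simp]: "coord (- x) i = - coord x i"
  by (simp add: uminus_finseq_def coord_Abs finite_coord)

lemma coord_scaleR [simp]: "coord (scaleR a x) i = a * coord x i"
proof -
  have "finite {i. a * coord x i \<noteq> 0}"
    by (rule finite_subset[OF _ finite_coord[of x]]) auto
  then show ?thesis
    by (simp add: scaleR_finseq_def coord_Abs)
qed

instance
  by standard (auto intro!: finseq_eqI simp: algebra_simps)

end

instantiation finseq :: real_inner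
begin

definition "inner x y = (\<Sum>i | coord x i \<noteq> 0. coord x i * coord y i)"
definition "norm (x :: finseq) = sqrt (inner x x)"
definition "sgn (x :: finseq) = x /\<^sub>R norm x"
definition "dist (x :: finseq) y = norm (x - y)"
definition "(uniformity :: (finseq \<times> finseq) filter) =
  (INF e\<in>{0<..}. principal {(x, y). dist x y < e})"
definition "open (U :: finseq set) \<longleftrightarrow>
  (\<forall>x\<in>U. \<forall>\<^sub>F (x', y) in uniformity. x' = x \<longrightarrow> y \<in> U)"

lemma inner_finseq_superset:
  assumes "finite A" "{i. coord x i \<noteq> 0} \<subseteq> A"
  shows "inner x y = (\<Sum>i\<in>A. coord x i * coord y i)"
  unfolding inner_finseq_def by (rule sum.mono_neutral_left) (use assms in auto)

instance
proof
  fix x y z :: finseq and a :: real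
  let ?A = "{i. coord x i \<noteq> 0} \<union> {i. coord y i \<noteq> 0}"
  have fin: "finite ?A"
    by (simp add: finite_coord)
  have x: "inner x w = (\<Sum>i\<in>?A. coord x i * coord w i)" for w
    by (rule inner_finseq_superset[OF fin]) auto
  have y: "inner y w = (\<Sum>i\<in>?A. coord y i * coord w i)" for w
    by (rule inner_finseq_superset[OF fin]) auto
  have xy: "inner (x + y) w = (\<Sum>i\<in>?A. coord (x + y) i * coord w i)" for w
    by (rule inner_finseq_superset[OF fin]) auto
  have ax: "inner (scaleR a x) w = (\<Sum>i\<in>?A. coord (scaleR a x) i * coord w i)" for w
    by (rule inner_finseq_superset[OF fin]) auto
  show "inner x y = inner y x"
    unfolding x y by (simp add: mult.commute)
  show "inner (x + y) z = inner x z + inner y z"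
    unfolding x y xy by (simp add: sum.distrib algebra_simps)
  show "inner (scaleR a x) y = a * inner x y"
    unfolding x ax by (simp add: sum_distrib_left algebra_simps)
  show "0 \<le> inner x x"
    unfolding x by (simp add: sum_nonneg)
  show "inner x x = 0 \<longleftrightarrow> x = 0"
  proof
    assume "inner x x = 0"
    then have "\<forall>i\<in>{i. coord x i \<noteq> 0}. coord x i * coord x i = 0"
      unfolding inner_finseq_def by (subst (asm) sum_nonneg_eq_0_iff) (auto simp: finite_coord)
    then show "x = 0"
      by (intro finseq_eqI) auto
  qed (simp add: inner_finseq_def)
qed (simp_all add: norm_finseq_def sgn_finseq_def dist_finseq_def
      uniformity_finseq_def open_finseq_def)

end

definition Rd :: "nat \<Rightarrow> finseq set" where
  "Rd d = {x. \<forall>i\<ge>d. coord x i = 0}"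

text \<open>
  The next two lemmas say that restricting the coordinates to \<open>{..<d}\<close> identifies
  \<open>Rd d\<close> isometrically with Euclidean \<open>\<real>\<^sup>d\<close>.
\<close>

lemma Rd_coordinates: "\<exists>!x. x \<in> Rd d \<and> (\<forall>i<d. coord x i = f i)"
proof (rule ex1I)
  have "finite {i. (if i < d then f i else 0) \<noteq> 0}"
    by (rule finite_subset[of _ "{..<d}"]) auto
  then show "Abs_finseq (\<lambda>i. if i < d then f i else 0) \<in> Rd d \<and>
      (\<forall>i<d. coord (Abs_finseq (\<lambda>i. if i < d then f i else 0)) i = f i)"
    by (simp add: Rd_def coord_Abs)
  fix x
  assume "x \<in> Rd d \<and> (\<forall>i<d. coord x i = f i)"
  then show "x = Abs_finseq (\<lambda>i. if i < d then f i else 0)"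
    using \<open>finite _\<close> by (intro finseq_eqI) (auto simp: Rd_def coord_Abs)
qed

lemma dist_Rd:
  assumes "x \<in> Rd d" "y \<in> Rd d"
  shows "dist x y = sqrt (\<Sum>i<d. (coord x i - coord y i)\<^sup>2)"
proof -
  have sub: "{i. coord (x - y) i \<noteq> 0} \<subseteq> {..<d}"
    using assms by (force simp: Rd_def linorder_not_less[symmetric])
  show ?thesis
    unfolding dist_finseq_def norm_finseq_def inner_finseq_superset[OF finite_lessThan sub]
    by (simp add: power2_eq_square)
qed

text \<open>
  \<open>diameter\<close> is only meaningful for bounded sets, so boundedness of the covering sets is
  required explicitly. Only exponents \<open>s > 0\<close> are used below (note that \<open>0 powr 0 = 0\<close>).
\<close>

definition hausdorff_premeasure :: "real \<Rightarrow> real \<Rightarrow> 'a::metric_space set \<Rightarrow> ennreal" where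
  "hausdorff_premeasure s \<delta> A =
     Inf {(\<Sum>i. ennreal (diameter (U i) powr s)) | U :: nat \<Rightarrow> 'a set.
            A \<subseteq> (\<Union>i. U i) \<and> (\<forall>i. bounded (U i) \<and> diameter (U i) \<le> \<delta>)}"

definition hausdorff_measure :: "real \<Rightarrow> 'a::metric_space set \<Rightarrow> ennreal" where
  "hausdorff_measure s A = (SUP \<delta>\<in>{0<..}. hausdorff_premeasure s \<delta> A)"

definition hausdorff_dim :: "'a::metric_space set \<Rightarrow> ereal" where
  "hausdorff_dim A = Inf {ereal s | s. 0 < s \<and> hausdorff_measure s A = 0}"

definition convex_density :: "'a::real_normed_vector set \<Rightarrow> 'a \<Rightarrow> real \<Rightarrow> real" where
  "convex_density K x r = diameter (convex hull (K \<inter> cball x r)) / (2 * r)"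

definition lower_mean_density :: "'a::real_normed_vector set \<Rightarrow> 'a \<Rightarrow> ereal" where
  "lower_mean_density K x =
     Liminf (at_right 0)
       (\<lambda>r. ereal ((LBINT t=ereal r..ereal (diameter K). (convex_density K x t)\<^sup>2 / t) / (- ln r)))"

end

theory Submission
  imports Defs "HOL-Library.Sublist"
begin

text \<open>
  No point of \<open>K\<close> is isolated, so \<open>K\<close> carries a full binary tree of nodes \<open>(x, t)\<close> with
  \<open>x \<in> K\<close>: if \<open>y\<close> is a farthest point from \<open>x\<close> in \<open>K \<inter> cball x (t / 4)\<close> and
  \<open>a = dist x y\<close>, the children are \<open>(x, a / 4)\<close> and \<open>(y, a / 4)\<close>. At scales between
  \<open>a / 4\<close> and \<open>t\<close> the set \<open>K\<close> looks from a limit point \<open>z\<close> of the node like two clusters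
  at distance \<open>a\<close>, so \<open>d(z, r)\<close> is of order \<open>a / r\<close> and each generation contributes at most
  an absolute constant \<open>C = 136\<close> to the integral of \<open>d\<^sup>2 dr / r\<close>. If the lower mean density at
  \<open>z\<close> exceeds \<open>\<delta>\<close>, the radius of its \<open>n\<close>-th node is therefore at least
  \<open>exp (- C n / \<delta>)\<close> for large \<open>n\<close>. By a Baire category argument this holds uniformly below
  some node, and there \<open>2\<^sup>-\<^sup>n \<le> radius\<^sup>s\<close> with \<open>s = \<delta> ln 2 / C\<close>. A cover of \<open>K\<close> with small
  \<open>s\<close>-dimensional sum would then give countably many cylinders of small total weight covering
  the Cantor set, which Kraft's inequality excludes.
\<close>

section \<open>The density integral\<close>

definition density_integral :: "'a::real_normed_vector set \<Rightarrow> 'a \<Rightarrow> real \<Rightarrow> real" where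
  "density_integral K x r = (LBINT t=ereal r..ereal (diameter K). (convex_density K x t)\<^sup>2 / t)"

lemma density_integral_gt:
  assumes "ereal \<delta> < lower_mean_density K x"
  shows "\<exists>\<rho>>0. \<forall>r. 0 < r \<and> r < \<rho> \<longrightarrow> \<delta> * (- ln r) < density_integral K x r"
proof -
  have "\<forall>\<^sub>F r in at_right 0. ereal \<delta> < ereal (density_integral K x r / (- ln r))"
    using assms unfolding lower_mean_density_def density_integral_def by (rule less_LiminfD)
  then obtain b where b: "b > 0"
    "\<And>r. 0 < r \<Longrightarrow> r < b \<Longrightarrow> \<delta> < density_integral K x r / (- ln r)"
    unfolding eventually_at_right_field by auto
  \<comment> \<open>Below 1 the factor \<open>- ln r\<close> is positive, so the quotient bound can
    be multiplied out.\<close>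
  show ?thesis
  proof (intro exI[of _ "min b 1"] conjI allI impI)
    fix r :: real
    assume r: "0 < r \<and> r < min b 1"
    then have "0 < - ln r"
      by simp
    with b(2)[of r] r show "\<delta> * (- ln r) < density_integral K x r"
      by (simp only: less_divide_eq) auto
  qed (use b in auto)
qed

text \<open>Monotonicity of the integral covers a nonintegrable integrand as well: its Bochner
  integral is 0 by convention, and \<open>g\<close> is nonnegative.\<close>

lemma density_integral_le:
  assumes "compact K" and g: "has_bochner_integral lborel g v" and nonneg: "\<And>t. 0 \<le> g t"
    and le: "\<And>t. r \<le> t \<Longrightarrow> t \<le> diameter K \<Longrightarrow> (convex_density K x t)\<^sup>2 / t \<le> g t"
  shows "density_integral K x r \<le> v"
proof -
  let ?f = "\<lambda>t. (convex_density K x t)\<^sup>2 / t"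
  have v: "v = integral\<^sup>L lborel g" "integrable lborel g"
    using g by (simp_all add: has_bochner_integral_iff)
  show ?thesis
  proof (cases "r \<le> diameter K")
    case True
    have "density_integral K x r = integral\<^sup>L lborel (\<lambda>t. indicator {r..diameter K} t *\<^sub>R ?f t)"
      using True by (simp add: density_integral_def interval_integral_Icc set_lebesgue_integral_def)
    also have "\<dots> \<le> integral\<^sup>L lborel g"
      by (rule integral_mono'[OF v(2)]) (use nonneg le in \<open>auto simp: indicator_def\<close>)
    finally show ?thesis
      using v by simp
  next
    case False
    have "0 \<le> diameter K"
      using assms(1) by (simp add: compact_imp_bounded diameter_ge_0)
    \<comment> \<open>The limits are in reverse order here, so the integral is minus that of a
      nonnegative function.\<close>
    have "density_integral K x r = - (LBINT t=ereal (diameter K)..ereal r. ?f t)"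
      unfolding density_integral_def by (rule interval_integral_endpoints_reverse)
    also have "\<dots> = - integral\<^sup>L lborel (\<lambda>t. indicator {diameter K..r} t *\<^sub>R ?f t)"
      using False by (simp add: interval_integral_Icc set_lebesgue_integral_def)
    also have "\<dots> \<le> 0"
      using \<open>0 \<le> diameter K\<close> by (auto intro!: integral_nonneg_AE simp: indicator_def)
    also have "\<dots> \<le> v"
      using v nonneg by simp
    finally show ?thesis .
  qed
qed

lemma convex_density_nonneg: "0 \<le> convex_density K x t" if "0 < t" "compact K"
proof -
  have "bounded (convex hull (K \<inter> cball x t))"
    by (simp add: bounded_convex_hull bounded_Int)
  then show ?thesis
    using that by (simp add: convex_density_def diameter_ge_0)
qed

text \<open>Balls are convex, so one that contains the portion of \<open>K\<close> contains its
  hull. The choice \<open>a = t\<close> gives the trivial bound 1, and \<open>a = 0\<close> gives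
  density 0.\<close>

lemma convex_density_le:
  assumes "0 < t" "0 \<le> a" "K \<inter> cball x t \<subseteq> cball y a"
  shows "convex_density K x t \<le> a / t"
proof -
  have "convex hull (K \<inter> cball x t) \<subseteq> cball y a"
    using assms by (intro hull_minimal) auto
  then have "diameter (convex hull (K \<inter> cball x t)) \<le> diameter (cball y a)"
    by (intro diameter_subset) auto
  also have "\<dots> \<le> 2 * a"
  proof (rule diameter_le)
    fix u v
    assume "u \<in> cball y a" "v \<in> cball y a"
    then show "norm (u - v) \<le> 2 * a"
      using dist_triangle2[of u v y] by (simp add: dist_norm norm_minus_commute)
  qed (use assms in auto)
  finally show ?thesis
    using assms by (simp add: convex_density_def field_simps)
qed

section \<open>Branches of the binary tree\<close>

text \<open>Nodes are words with the most recent letter first, so extending a node is \<open>Cons\<close> and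
  descendants are recognised by \<open>suffix\<close>.\<close>

primrec pre :: "(nat \<Rightarrow> bool) \<Rightarrow> nat \<Rightarrow> bool list" where
  "pre \<sigma> 0 = []"
| "pre \<sigma> (Suc n) = \<sigma> n # pre \<sigma> n"

lemma length_pre [simp]: "length (pre \<sigma> n) = n"
  by (induction n) auto

lemma suffix_pre: "m \<le> n \<Longrightarrow> suffix (pre \<sigma> m) (pre \<sigma> n)"
  by (induction n) (auto simp: le_Suc_eq intro: suffix_ConsI)

lemma pre_limit:
  assumes "\<And>n. strict_suffix (v n) (v (Suc n))"
  shows "\<exists>\<sigma>. \<forall>n. pre \<sigma> (length (v n)) = v n"
proof -
  have suf: "suffix (v m) (v n)" if "m \<le> n" for m n
    using suffix_order.lift_Suc_mono_le[of v m n] assms that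
    by (simp add: suffix_order.less_imp_le)
  have len: "n \<le> length (v n)" for n
  proof (induction n)
    case (Suc n)
    have "length (v n) < length (v (Suc n))"
      using assms[of n] by (auto simp: strict_suffix_def suffix_def)
    with Suc show ?case by simp
  qed simp
  \<comment> \<open>\<open>v (Suc k)\<close> has more than \<open>k\<close> letters, and
    \<open>rev\<close> puts the oldest letter first.\<close>
  define \<sigma> where "\<sigma> k = rev (v (Suc k)) ! k" for k
  have \<sigma>: "rev (v n) ! k = \<sigma> k" if "k < length (v n)" for n k
  proof -
    have nth: "rev (v p) ! k = rev (v q) ! k" if "p \<le> q" "k < length (v p)" for p q
      using suf[OF that(1)] that(2) by (auto simp: suffix_def nth_append)
    show ?thesis
      unfolding \<sigma>_def using nth[of n "Suc k"] nth[of "Suc k" n] that len[of "Suc k"]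
      by (metis Suc_le_lessD nat_le_linear)
  qed
  have pre: "pre \<sigma> n = rev (map \<sigma> [0..<n])" for n
    by (induction n) auto
  have "pre \<sigma> (length (v n)) = v n" for n
  proof -
    have "map \<sigma> [0..<length (v n)] = rev (v n)"
      by (rule nth_equalityI) (auto simp: \<sigma>)
    then show ?thesis
      by (simp add: pre)
  qed
  then show ?thesis by blast
qed

lemma ex_branch_avoiding:
  fixes w :: "nat \<Rightarrow> bool list"
  assumes "(\<Sum>i. ennreal ((1/2) ^ length (w i))) < ennreal ((1/2) ^ length u)"
  shows "\<exists>\<sigma>. pre \<sigma> (length u) = u \<and> (\<forall>i. pre \<sigma> (length (w i)) \<noteq> w i)"
proof -
  \<comment> \<open>Descend from \<open>u\<close> so that the weight of the words below the current node stays too small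
    to fill it; by superadditivity one of the two children always qualifies.\<close>
  define S where "S v = (\<Sum>i. if suffix v (w i) then ennreal ((1/2) ^ length (w i)) else 0)" for v
  define P where "P v \<longleftrightarrow> S v < ennreal ((1/2) ^ length v)" for v
  have S_child: "S (True # v) + S (False # v) \<le> S v" for v
    unfolding S_def
  proof (subst suminf_add)
    have "\<not> (suffix (True # v) x \<and> suffix (False # v) x)" for x
      by (auto simp: suffix_def)
    then show "(\<Sum>n. (if suffix (True # v) (w n) then ennreal ((1/2) ^ length (w n)) else 0) +
        (if suffix (False # v) (w n) then ennreal ((1/2) ^ length (w n)) else 0))
      \<le> (\<Sum>n. if suffix v (w n) then ennreal ((1/2) ^ length (w n)) else 0)"
      by (intro suminf_le) (auto simp: suffix_def)
  qed auto
  have step: "\<exists>b. P (b # v)" if "P v" for v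
  proof (rule ccontr)
    assume "\<nexists>b. P (b # v)"
    then have "ennreal ((1/2) ^ Suc (length v)) \<le> S (b # v)" for b
      by (simp add: P_def not_less)
    then have "ennreal ((1/2) ^ Suc (length v)) + ennreal ((1/2) ^ Suc (length v)) \<le> S v"
      using add_mono[of _ "S (True # v)" _ "S (False # v)"] S_child[of v] by (meson order_trans)
    then have "ennreal ((1/2) ^ length v) \<le> S v"
      by (subst (asm) ennreal_plus[symmetric]) auto
    with that show False
      by (simp add: P_def)
  qed
  have "S u \<le> (\<Sum>i. ennreal ((1/2) ^ length (w i)))"
    unfolding S_def by (intro suminf_le) auto
  then have "P u"
    using assms by (simp add: P_def)
  then obtain v where v: "v 0 = u" "\<And>n. P (v n)" "\<And>n. \<exists>b. v (Suc n) = b # v n"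
    using dependent_nat_choice[of "\<lambda>n v. P v \<and> (n = 0 \<longrightarrow> v = u)" "\<lambda>n v v'. \<exists>b. v' = b # v"] step
    by (metis (no_types, lifting) nat.distinct(1))
  have len: "length (v n) = length u + n" for n
    by (induction n) (use v in \<open>auto, metis add_Suc_right length_Cons\<close>)
  have "strict_suffix (v n) (v (Suc n))" for n
    using v(3)[of n] by (auto simp: strict_suffix_def suffix_def)
  then obtain \<sigma> where \<sigma>: "\<And>n. pre \<sigma> (length (v n)) = v n"
    using pre_limit[of v] by blast
  have "pre \<sigma> (length (w i)) \<noteq> w i" for i
  proof
    assume eq: "pre \<sigma> (length (w i)) = w i"
    have term_le: "f i \<le> suminf f" for f :: "nat \<Rightarrow> ennreal"
      using sum_le_suminf[of f "{i}"] by simp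
    \<comment> \<open>A word no longer than \<open>u\<close> would alone weigh at least as much as
      \<open>u\<close>. A longer one would be some \<open>v n\<close>, and its own weight already
      fills \<open>S (v n)\<close>.\<close>
    show False
    proof (cases "length (w i) \<le> length u")
      case True
      then have "ennreal ((1/2) ^ length u) \<le> ennreal ((1/2) ^ length (w i))"
        by (intro ennreal_leI power_decreasing) auto
      also have "\<dots> \<le> (\<Sum>i. ennreal ((1/2) ^ length (w i)))"
        by (rule term_le)
      finally show False
        using assms by simp
    next
      case False
      then obtain n where n: "length (w i) = length u + n"
        by (metis le_add_diff_inverse nat_le_linear)
      then have vn: "v n = w i"
        using \<sigma>[of n] eq len by simp
      have "ennreal ((1/2) ^ length (w i)) \<le> S (v n)"
        using term_le[of "\<lambda>i. if suffix (v n) (w i) then ennreal ((1/2) ^ length (w i)) else 0"]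
        by (simp add: S_def vn)
      with v(2)[of n] show False
        by (simp add: P_def vn)
    qed
  qed
  moreover have "pre \<sigma> (length u) = u"
    using \<sigma>[of 0] v by simp
  ultimately show ?thesis by blast
qed


section \<open>Binary trees in a set of positive mean density\<close>

text \<open>Near an isolated point the density vanishes at small scales, so its integral stays
  bounded, whereas positive mean density makes it grow like \<open>- ln r\<close>.\<close>

lemma ex_other_point_near:
  assumes "compact K" "x \<in> K" "0 < lower_mean_density K x" "0 < \<rho>"
  shows "\<exists>y\<in>K. y \<noteq> x \<and> dist x y \<le> \<rho>"
proof (rule ccontr)
  assume "\<not> ?thesis"
  then have sub: "K \<inter> cball x t \<subseteq> cball x 0" if "t \<le> \<rho>" for t
    using that by force
  define b where "b = max \<rho> (diameter K)"
  define g where "g t = 1 / t * indicator {\<rho>..b} t" for t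
  have g: "has_bochner_integral lborel g (ln b - ln \<rho>)"
    unfolding g_def
    by (rule has_bochner_integral_FTC_Icc_real)
       (use assms in \<open>auto simp: b_def intro!: derivative_eq_intros\<close>)
  have bound: "density_integral K x r \<le> ln b - ln \<rho>" if "0 < r" for r
  proof (rule density_integral_le[OF assms(1) g])
    show "0 \<le> g t" for t
      using assms by (auto simp: g_def indicator_def)
    fix t
    assume t: "r \<le> t" "t \<le> diameter K"
    show "(convex_density K x t)\<^sup>2 / t \<le> g t"
    proof (cases "t < \<rho>")
      case True
      then have "convex_density K x t = 0"
        using convex_density_le[of t 0 K x x] convex_density_nonneg[of t K x] sub[of t] t that assms
        by auto
      then show ?thesis
        using \<open>\<And>t. 0 \<le> g t\<close> by simp
    next
      case False
      have "(convex_density K x t)\<^sup>2 \<le> 1"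
        using convex_density_le[of t t K x x] convex_density_nonneg[of t K x] t that assms
        by (auto simp: power_le_one)
      then show ?thesis
        using False t that by (auto simp: g_def b_def field_simps)
    qed
  qed
  obtain \<delta> where \<delta>: "0 < ereal \<delta>" "ereal \<delta> < lower_mean_density K x"
    using ereal_dense2[OF assms(3)] by blast
  then have "0 < \<delta>"
    by simp
  obtain \<rho>' where \<rho>': "\<rho>' > 0" "\<And>r. 0 < r \<Longrightarrow> r < \<rho>' \<Longrightarrow> \<delta> * (- ln r) < density_integral K x r"
    using density_integral_gt[OF \<delta>(2)] by blast
  \<comment> \<open>Chosen so small that \<open>\<delta> * (- ln r)\<close> is at least the uniform
    bound \<open>ln b - ln \<rho>\<close>.\<close>
  define r where "r = min (\<rho>' / 2) (exp (- (ln b - ln \<rho>) / \<delta>))"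
  have r: "0 < r" "r < \<rho>'" "r \<le> exp (- (ln b - ln \<rho>) / \<delta>)"
    using \<rho>' by (auto simp: r_def)
  then have "ln r \<le> - (ln b - ln \<rho>) / \<delta>"
    by (metis exp_gt_zero ln_exp ln_le_cancel_iff)
  then have "ln b - ln \<rho> \<le> \<delta> * (- ln r)"
    using \<open>0 < \<delta>\<close> by (simp add: field_simps)
  with \<rho>'(2)[of r] bound[of r] r show False
    by simp
qed

text \<open>Let a = \<open>4 * T (b # w)\<close>, the largest distance from \<open>X w\<close> to
  points of \<open>K\<close> within \<open>T w / 4\<close>. Then \<open>T_Cons_le\<close> is a <=
  \<open>T w / 4\<close>, and \<open>farthest\<close> leaves a gap in \<open>K\<close> between the
  distances a and \<open>T w / 4\<close>. The free \<open>b\<close> forces equal radii on siblings;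
  \<open>T_Nil\<close> lets the levels cover the range of integration.\<close>

locale branching_tree =
  fixes K :: "'a::real_normed_vector set" and X :: "bool list \<Rightarrow> 'a" and T :: "bool list \<Rightarrow> real"
  assumes compact: "compact K"
    and X_in: "X w \<in> K"
    and T_pos: "0 < T w"
    and T_Nil: "T [] = diameter K"
    and X_False: "X (False # w) = X w"
    and X_True: "dist (X w) (X (True # w)) = 4 * T (b # w)"
    and T_Cons_le: "16 * T (b # w) \<le> T w"
    and farthest: "y \<in> K \<Longrightarrow> dist (X w) y \<le> T w / 4 \<Longrightarrow> dist (X w) y \<le> 4 * T (b # w)"
begin

lemma T_Cons_eq: "T (b # w) = T (b' # w)"
  using X_True[of w b] X_True[of w b'] by simp

lemma dist_X_Cons: "dist (X w) (X (b # w)) \<le> 4 * T (b # w)"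
  using X_True[of w b] X_False[of w] T_pos[of "b # w"] by (cases b) auto

lemma dist_X_of_child:
  assumes "dist z (X (b # w)) \<le> T (b # w) / 3"
  shows "dist z (X w) \<le> 13/3 * T (b # w)"
  using dist_triangle[of z "X w" "X (b # w)"] dist_X_Cons[of w b] assms
  by (simp add: dist_commute)

lemma T_pre_le: "T (pre \<sigma> n) \<le> T [] * (1/2) ^ n"
proof (induction n)
  case (Suc n)
  then show ?case
    using T_Cons_le[of "\<sigma> n" "pre \<sigma> n"] T_pos[of "pre \<sigma> (Suc n)"] by simp
qed simp

lemma T_pre_antimono: "m \<le> n \<Longrightarrow> T (pre \<sigma> n) \<le> T (pre \<sigma> m)"
proof (induction n)
  case (Suc n)
  then show ?case
    using T_Cons_le[of "\<sigma> n" "pre \<sigma> n"] T_pos[of "pre \<sigma> (Suc n)"]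
    by (auto simp: le_Suc_eq)
qed simp

lemma ex_T_pre_less: "0 < e \<Longrightarrow> \<exists>n. T (pre \<sigma> n) < e"
proof -
  assume "0 < e"
  then obtain n where "(1/2 :: real) ^ n < e / T []"
    using real_arch_pow_inv[of "e / T []" "1/2"] T_pos[of "[]"] by auto
  then have "T [] * (1/2) ^ n < e"
    using T_pos[of "[]"] by (simp add: field_simps)
  then show ?thesis
    using T_pre_le[of \<sigma> n] by (intro exI[of _ n]) linarith
qed

section \<open>Limit points of branches and their separation\<close>

lemma ex_limit: "\<exists>z\<in>K. \<forall>n. dist z (X (pre \<sigma> n)) \<le> T (pre \<sigma> n) / 3"
proof -
  define F where "F n = K \<inter> cball (X (pre \<sigma> n)) (T (pre \<sigma> n) / 3)" for n
  have "K \<inter> (\<Inter>n. cball (X (pre \<sigma> n)) (T (pre \<sigma> n) / 3)) \<noteq> {}"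
  proof (rule compact_imp_fip_image[OF compact])
    \<comment> \<open>The balls are nested since 13/3 * 1/16 = 13/48 < 1/3. Compactness of
      \<open>K\<close> then stands in for completeness of the ambient space.\<close>
    have "F (Suc n) \<subseteq> F n" for n
    proof
      fix z
      assume "z \<in> F (Suc n)"
      then show "z \<in> F n"
        using dist_X_of_child[of z "\<sigma> n" "pre \<sigma> n"] T_Cons_le[of "\<sigma> n" "pre \<sigma> n"]
          T_pos[of "\<sigma> n # pre \<sigma> n"]
        by (simp add: F_def dist_commute)
    qed
    then have mono: "F n \<subseteq> F m" if "m \<le> n" for m n
      using lift_Suc_antimono_le[of F m n] that by simp
    fix I :: "nat set"
    assume "finite I"
    then obtain N where "\<And>n. n \<in> I \<Longrightarrow> n \<le> N"
      by (meson finite_nat_set_iff_bounded_le)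
    moreover have "X (pre \<sigma> N) \<in> F N"
      using X_in T_pos[of "pre \<sigma> N"] by (simp add: F_def less_imp_le)
    ultimately have "X (pre \<sigma> N) \<in> K \<inter> (\<Inter>n\<in>I. F n)"
      using mono X_in by blast
    then show "K \<inter> (\<Inter>n\<in>I. cball (X (pre \<sigma> n)) (T (pre \<sigma> n) / 3)) \<noteq> {}"
      unfolding F_def by blast
  qed auto
  then show ?thesis
    by (force simp: dist_commute)
qed

definition Z :: "(nat \<Rightarrow> bool) \<Rightarrow> 'a" where
  "Z \<sigma> = (SOME z. z \<in> K \<and> (\<forall>n. dist z (X (pre \<sigma> n)) \<le> T (pre \<sigma> n) / 3))"

lemma Z_in: "Z \<sigma> \<in> K" and dist_Z: "dist (Z \<sigma>) (X (pre \<sigma> n)) \<le> T (pre \<sigma> n) / 3"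
  using someI_ex[of "\<lambda>z. z \<in> K \<and> (\<forall>n. dist z (X (pre \<sigma> n)) \<le> T (pre \<sigma> n) / 3)"] ex_limit[of \<sigma>]
  unfolding Z_def by blast+

text \<open>At the first disagreement the siblings have radius t and distance 4 t, and each limit
  point is within t / 3 of its node, which leaves 10/3 t. Deeper radii are smaller still.\<close>

lemma dist_Z_gt:
  assumes "pre \<sigma> n \<noteq> pre \<tau> n"
  shows "T (pre \<sigma> n) < dist (Z \<sigma>) (Z \<tau>)"
  using assms
proof (induction n)
  case (Suc n)
  show ?case
  proof (cases "pre \<sigma> n = pre \<tau> n")
    case False
    then show ?thesis
      using Suc T_pre_antimono[of n "Suc n" \<sigma>] by force
  next
    case True
    let ?w = "pre \<sigma> n" and ?t = "T (pre \<sigma> (Suc n))"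
    have "\<tau> n = (\<not> \<sigma> n)" and \<tau>: "pre \<tau> (Suc n) = \<tau> n # ?w"
      using Suc.prems True by auto
    then have "dist (X (pre \<sigma> (Suc n))) (X (pre \<tau> (Suc n))) = 4 * ?t"
      using X_False[of ?w] X_True[of ?w "\<sigma> n"] by (cases "\<sigma> n") (auto simp: dist_commute)
    moreover have "T (pre \<tau> (Suc n)) = ?t"
      unfolding \<tau> using T_Cons_eq by simp
    moreover have "dist (X (pre \<sigma> (Suc n))) (X (pre \<tau> (Suc n)))
        \<le> dist (Z \<sigma>) (X (pre \<sigma> (Suc n))) + dist (Z \<sigma>) (Z \<tau>) + dist (Z \<tau>) (X (pre \<tau> (Suc n)))"
      using dist_triangle[of "X (pre \<sigma> (Suc n))" "X (pre \<tau> (Suc n))" "Z \<sigma>"]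
        dist_triangle[of "Z \<sigma>" "X (pre \<tau> (Suc n))" "Z \<tau>"]
      by (simp only: dist_commute[of "Z \<sigma>" "X (pre \<sigma> (Suc n))"])
    ultimately show ?thesis
      using dist_Z[of \<sigma> "Suc n"] dist_Z[of \<tau> "Suc n"] T_pos[of "pre \<sigma> (Suc n)"] by linarith
  qed
qed simp

text \<open>The first summand dominates while \<open>cball (Z \<sigma>) t\<close> stays inside the search ball of the node;
  the second one takes over for \<open>t\<close> comparable to the radius of the node.\<close>

definition majorant :: "(nat \<Rightarrow> bool) \<Rightarrow> nat \<Rightarrow> real \<Rightarrow> real" where
  "majorant \<sigma> n t = (16 * (T (pre \<sigma> (Suc n)))\<^sup>2 / t ^ 3 + 256 * t / (T (pre \<sigma> n))\<^sup>2)
     * indicator {T (pre \<sigma> (Suc n))..T (pre \<sigma> n)} t"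

lemma majorant_nonneg: "0 \<le> majorant \<sigma> n t"
  using T_pos[of "pre \<sigma> (Suc n)"] by (auto simp: majorant_def indicator_def)

text \<open>136 = 8 + 128: the summands integrate to 8 (1 - a^2 / b^2) and 128 (1 - a^2 / b^2),
  where a and b are the two radii.\<close>

lemma has_bochner_integral_majorant: "\<exists>v\<le>136. has_bochner_integral lborel (majorant \<sigma> n) v"
proof -
  define a b where "a = T (pre \<sigma> (Suc n))" and "b = T (pre \<sigma> n)"
  have ab: "0 < a" "a \<le> b"
    using T_pos T_pre_antimono[of n "Suc n" \<sigma>] by (auto simp: a_def b_def)
  let ?F = "\<lambda>t. - 8 * a\<^sup>2 / t\<^sup>2 + 128 * t\<^sup>2 / b\<^sup>2"
  have "has_bochner_integral lborel (majorant \<sigma> n) (?F b - ?F a)"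
    unfolding majorant_def a_def[symmetric] b_def[symmetric]
  proof (rule has_bochner_integral_FTC_Icc_real)
    fix t
    assume "a \<le> t" "t \<le> b"
    with ab have "t > 0" by simp
    with ab show "(?F has_real_derivative 16 * a\<^sup>2 / t ^ 3 + 256 * t / b\<^sup>2) (at t)"
      by (auto intro!: derivative_eq_intros simp: field_simps power2_eq_square power3_eq_cube)
    show "isCont (\<lambda>t. 16 * a\<^sup>2 / t ^ 3 + 256 * t / b\<^sup>2) t"
      using \<open>t > 0\<close> ab by (auto intro!: continuous_intros)
  qed (use ab in auto)
  moreover have "?F b - ?F a \<le> 136"
  proof -
    have "?F b - ?F a = 136 - 8 * a\<^sup>2 / b\<^sup>2 - 128 * a\<^sup>2 / b\<^sup>2"
      using ab by (simp add: field_simps)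
    also have "\<dots> \<le> 136"
      by simp
    finally show ?thesis .
  qed
  ultimately show ?thesis by blast
qed

lemma convex_density_le_majorant:
  assumes t: "T (pre \<sigma> (Suc n)) \<le> t" "t \<le> T (pre \<sigma> n)"
  shows "(convex_density K (Z \<sigma>) t)\<^sup>2 / t \<le> majorant \<sigma> n t"
proof -
  define a b where "a = T (pre \<sigma> (Suc n))" and "b = T (pre \<sigma> n)"
  define d where "d = convex_density K (Z \<sigma>) t"
  have ab: "0 < a" "0 < t" "0 < b"
    using T_pos[of "pre \<sigma> (Suc n)"] T_pos[of "pre \<sigma> n"] t by (auto simp: a_def b_def)
  have d: "0 \<le> d" "d \<le> 1"
    using convex_density_nonneg[of t K "Z \<sigma>"] convex_density_le[of t t K "Z \<sigma>" "Z \<sigma>"] ab compact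
    by (auto simp: d_def)
  \<comment> \<open>If one of the right-hand sides is at least 1, then \<open>d \<le> 1\<close>
    suffices. Otherwise 4 a < t < b / 16, and the ball around \<open>Z \<sigma>\<close> stays within
    13/3 a + t < 25/12 t < b / 4 of the node; the gap in \<open>K\<close> then confines its points
    to radius 4 a.\<close>
  have "d \<le> 4 * a / t \<or> d \<le> 16 * t / b"
  proof (cases "b \<le> 16 * t \<or> t \<le> 4 * a")
    case True
    then have "1 \<le> 4 * a / t \<or> 1 \<le> 16 * t / b"
      using ab by (auto simp: field_simps)
    with d show ?thesis by linarith
  next
    case False
    have Z: "dist (Z \<sigma>) (X (pre \<sigma> n)) \<le> 13/3 * a"
      using dist_X_of_child[of "Z \<sigma>" "\<sigma> n" "pre \<sigma> n"] dist_Z[of \<sigma> "Suc n"] by (simp add: a_def)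
    have "K \<inter> cball (Z \<sigma>) t \<subseteq> cball (X (pre \<sigma> n)) (4 * a)"
    proof
      fix y
      assume y: "y \<in> K \<inter> cball (Z \<sigma>) t"
      have "dist (X (pre \<sigma> n)) y \<le> dist (Z \<sigma>) (X (pre \<sigma> n)) + dist (Z \<sigma>) y"
        by metric
      also have "\<dots> \<le> b / 4"
        using y Z False ab by auto
      finally show "y \<in> cball (X (pre \<sigma> n)) (4 * a)"
        using farthest[of y "pre \<sigma> n" "\<sigma> n"] y by (simp add: a_def b_def)
    qed
    then show ?thesis
      using convex_density_le[of t "4 * a" K "Z \<sigma>" "X (pre \<sigma> n)"] ab by (auto simp: d_def)
  qed
  then have "d\<^sup>2 \<le> (4 * a / t)\<^sup>2 \<or> d\<^sup>2 \<le> (16 * t / b)\<^sup>2"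
    using d power_mono[of d _ 2] by blast
  then have "d\<^sup>2 \<le> (4 * a / t)\<^sup>2 + (16 * t / b)\<^sup>2"
    by (smt (verit) zero_le_power2)
  then have "d\<^sup>2 / t \<le> ((4 * a / t)\<^sup>2 + (16 * t / b)\<^sup>2) / t"
    using ab by (simp add: divide_right_mono)
  also have "\<dots> = 16 * a\<^sup>2 / t ^ 3 + 256 * t / b\<^sup>2"
    using ab by (simp add: field_simps power2_eq_square power3_eq_cube)
  finally show ?thesis
    using t by (simp add: majorant_def d_def a_def b_def)
qed

lemma ex_level:
  assumes "T (pre \<sigma> n) \<le> t" "t \<le> diameter K" "0 < n"
  shows "\<exists>k<n. T (pre \<sigma> (Suc k)) \<le> t \<and> t \<le> T (pre \<sigma> k)"
  using assms
proof (induction n)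
  case (Suc n)
  show ?case
  proof (cases "t \<le> T (pre \<sigma> n)")
    case True
    then show ?thesis
      using Suc.prems by auto
  next
    case False
    moreover have "0 < n"
      using False Suc.prems T_Nil by (cases n) auto
    ultimately show ?thesis
      using Suc by (metis less_Suc_eq linear)
  qed
qed simp

text \<open>The intervals between consecutive radii cover the range of integration, and each
  contributes at most 136.\<close>

lemma density_integral_Z_le:
  assumes "0 < n"
  shows "density_integral K (Z \<sigma>) (T (pre \<sigma> n)) \<le> 136 * real n"
proof -
  obtain v where v: "\<And>k. v k \<le> 136" "\<And>k. has_bochner_integral lborel (majorant \<sigma> k) (v k)"
    using has_bochner_integral_majorant[of \<sigma>] by metis
  have "density_integral K (Z \<sigma>) (T (pre \<sigma> n)) \<le> (\<Sum>k<n. v k)"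
  proof (rule density_integral_le[OF compact])
    show "has_bochner_integral lborel (\<lambda>t. \<Sum>k<n. majorant \<sigma> k t) (\<Sum>k<n. v k)"
      using v(2) by (rule has_bochner_integral_sum)
    show "0 \<le> (\<Sum>k<n. majorant \<sigma> k t)" for t
      by (simp add: majorant_nonneg sum_nonneg)
    fix t
    assume "T (pre \<sigma> n) \<le> t" "t \<le> diameter K"
    then obtain k where k: "k < n" "T (pre \<sigma> (Suc k)) \<le> t" "t \<le> T (pre \<sigma> k)"
      using ex_level assms by blast
    then have "(convex_density K (Z \<sigma>) t)\<^sup>2 / t \<le> majorant \<sigma> k t"
      by (intro convex_density_le_majorant)
    also have "\<dots> \<le> (\<Sum>k<n. majorant \<sigma> k t)"
      using k by (intro member_le_sum) (auto simp: majorant_nonneg)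
    finally show "(convex_density K (Z \<sigma>) t)\<^sup>2 / t \<le> (\<Sum>k<n. majorant \<sigma> k t)" .
  qed
  also have "\<dots> \<le> (\<Sum>k<n. 136)"
    by (intro sum_mono v)
  finally show ?thesis by simp
qed

text \<open>A Baire category argument: otherwise, repeatedly passing to a descendant that violates
  the bound leads to a branch whose limit point has too small a mean density.\<close>

lemma ex_node_radius_ge:
  fixes \<delta> :: "nat \<Rightarrow> real"
  assumes \<delta>: "\<And>k. 0 < \<delta> k" "antimono \<delta>"
    and dens: "\<And>x. x \<in> K \<Longrightarrow> \<exists>k. ereal (\<delta> k) < lower_mean_density K x"
  shows "\<exists>k u. \<forall>w. suffix u w \<longrightarrow> exp (- 136 * real (length w) / \<delta> k) \<le> T w"
proof (rule ccontr)
  assume "\<not> ?thesis"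
  then have neg: "\<exists>w. suffix u w \<and> T w < exp (- 136 * real (length w) / \<delta> k)" for k u
    by (meson not_le)
  have step: "\<exists>w. strict_suffix u w \<and> T w < exp (- 136 * real (length w) / \<delta> k)" for k u
  proof -
    \<comment> \<open>Starting from a child of \<open>u\<close> makes the descendant strict, so the
      lengths grow.\<close>
    obtain w where "suffix (True # u) w" "T w < exp (- 136 * real (length w) / \<delta> k)"
      using neg by blast
    then show ?thesis
      by (intro exI[of _ w]) (auto simp: strict_suffix_def suffix_def)
  qed
  obtain v where v: "\<And>k. T (v k) < exp (- 136 * real (length (v k)) / \<delta> k)"
      "\<And>k. strict_suffix (v k) (v (Suc k))"
    using dependent_nat_choice[of "\<lambda>k w. T w < exp (- 136 * real (length w) / \<delta> k)"
        "\<lambda>k w w'. strict_suffix w w'"] neg step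
    by metis
  obtain \<sigma> where \<sigma>: "\<And>k. pre \<sigma> (length (v k)) = v k"
    using pre_limit[of v] v by blast
  have len: "k \<le> length (v k)" for k
  proof (induction k)
    case (Suc k)
    have "length (v k) < length (v (Suc k))"
      using v(2)[of k] by (auto simp: strict_suffix_def suffix_def)
    with Suc show ?case by simp
  qed simp
  obtain j where "ereal (\<delta> j) < lower_mean_density K (Z \<sigma>)"
    using dens Z_in by blast
  then obtain \<rho> where \<rho>: "\<rho> > 0"
    "\<And>r. 0 < r \<Longrightarrow> r < \<rho> \<Longrightarrow> \<delta> j * (- ln r) < density_integral K (Z \<sigma>) r"
    using density_integral_gt by blast
  obtain m where m: "T (pre \<sigma> m) < \<rho>"
    using ex_T_pre_less \<rho> by blast
  \<comment> \<open>\<open>k\<close> is at least \<open>j\<close> so that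
    \<open>\<delta> k \<le> \<delta> j\<close>, at least \<open>m\<close> so that the radius of
    \<open>v k\<close> is below \<open>\<rho>\<close>, and at least 1 so that \<open>v k\<close> is
    nonempty.\<close>
  define k where "k = max (max j m) 1"
  define n where "n = length (v k)"
  have n: "m \<le> n" "0 < n"
    using len[of k] by (auto simp: n_def k_def)
  have "ln (T (v k)) < - 136 * real n / \<delta> k"
    using v(1)[of k] T_pos[of "v k"] unfolding n_def by (metis exp_gt_zero ln_exp ln_less_cancel_iff)
  then have "136 * real n < \<delta> k * (- ln (T (v k)))"
    using \<delta>(1)[of k] by (simp add: field_simps)
  moreover have "0 \<le> - ln (T (v k))"
    using calculation \<delta>(1)[of k] by (smt (verit) mult_nonneg_nonneg mult_nonneg_nonpos of_nat_0_le_iff)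
  then have "\<delta> k * (- ln (T (v k))) \<le> \<delta> j * (- ln (T (v k)))"
    using antimonoD[OF \<delta>(2), of j k] by (intro mult_right_mono) (auto simp: k_def)
  moreover have "\<delta> j * (- ln (T (v k))) < density_integral K (Z \<sigma>) (T (v k))"
    using T_pre_antimono[OF n(1), of \<sigma>] m \<sigma>[of k] T_pos[of "v k"] unfolding n_def
    by (intro \<rho>(2)) auto
  moreover have "density_integral K (Z \<sigma>) (T (v k)) \<le> 136 * real n"
    using density_integral_Z_le[OF n(2), of \<sigma>] \<sigma>[of k] by (simp add: n_def)
  ultimately show False by linarith
qed

section \<open>Positivity of the Hausdorff measure\<close>

text \<open>By \<open>dist_Z_gt\<close>, branches with limits in \<open>U\<close> share every node
  whose radius exceeds \<open>diameter U\<close>. The error \<open>e\<close> pays for sets that meet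
  no limit point or have diameter 0, where arbitrarily long words are available.\<close>

lemma ex_node_containing:
  assumes "0 < s" and radius: "\<And>w. suffix u w \<Longrightarrow> (1/2) ^ length w \<le> T w powr s"
    and U: "bounded U" "diameter U < T u" and "0 < e"
  shows "\<exists>w. (1/2) ^ length w \<le> 2 * diameter U powr s + e \<and>
    (\<forall>\<sigma>. pre \<sigma> (length u) = u \<and> Z \<sigma> \<in> U \<longrightarrow> pre \<sigma> (length w) = w)"
proof -
  obtain N where N: "(1/2 :: real) ^ N < e"
    using real_arch_pow_inv[of e "1/2"] \<open>0 < e\<close> by auto
  show ?thesis
  proof (cases "\<exists>\<sigma>. pre \<sigma> (length u) = u \<and> Z \<sigma> \<in> U")
    case False
    then show ?thesis
      using N by (intro exI[of _ "replicate N True"]) (auto intro: add_increasing)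
  next
    case True
    then obtain \<sigma> where \<sigma>: "pre \<sigma> (length u) = u" "Z \<sigma> \<in> U"
      by blast
    have common: "pre \<tau> n = pre \<sigma> n" if "diameter U < T (pre \<sigma> n)" "Z \<tau> \<in> U" for \<tau> n
      using dist_Z_gt[of \<sigma> n \<tau>] diameter_bounded_bound[OF U(1) \<sigma>(2) that(2)] that(1) by force
    have "0 \<le> diameter U"
      using U by (simp add: diameter_ge_0)
    then consider "diameter U = 0" | "0 < diameter U"
      by linarith
    then show ?thesis
    proof cases
      case 1
      then show ?thesis
        using N common T_pos[of "pre \<sigma> N"] by (intro exI[of _ "pre \<sigma> N"]) auto
    next
      case 2
      \<comment> \<open>The shared word ends one level earlier, at the last radius above
        \<open>diameter U\<close>; this costs the factor 2.\<close>
      define n where "n = (LEAST n. T (pre \<sigma> n) \<le> diameter U)"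
      have ex: "\<exists>n. T (pre \<sigma> n) \<le> diameter U"
        using ex_T_pre_less[OF 2] less_imp_le by blast
      have n: "T (pre \<sigma> n) \<le> diameter U"
        using LeastI_ex[OF ex] by (simp add: n_def)
      have "length u < n"
        using n U \<sigma> T_pre_antimono[of n "length u" \<sigma>] by (cases "length u < n") auto
      then obtain m where m: "n = Suc m" "length u \<le> m"
        by (cases n) auto
      have less: "diameter U < T (pre \<sigma> m)"
        using not_less_Least[of m "\<lambda>n. T (pre \<sigma> n) \<le> diameter U"] m by (simp add: n_def[symmetric])
      have "(1/2) ^ n \<le> T (pre \<sigma> n) powr s"
        using radius[of "pre \<sigma> n"] suffix_pre[of "length u" n \<sigma>] \<sigma> m by simp
      also have "\<dots> \<le> diameter U powr s"
        using n T_pos[of "pre \<sigma> n"] assms(1) by (intro powr_mono2) auto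
      finally have "(1/2) ^ m \<le> 2 * diameter U powr s"
        using m by simp
      then show ?thesis
        using common[OF less] \<open>0 < e\<close> by (intro exI[of _ "pre \<sigma> m"]) auto
    qed
  qed
qed

text \<open>A cover with small sum becomes a family of words too light to block every branch below
  \<open>u\<close>. The limit point of an unblocked branch would lie in \<open>K\<close> but in no
  covering set.\<close>

lemma hausdorff_measure_neq_0:
  assumes "0 < s" and radius: "\<And>w. suffix u w \<Longrightarrow> (1/2) ^ length w \<le> T w powr s"
  shows "hausdorff_measure s K \<noteq> 0"
proof
  assume "hausdorff_measure s K = 0"
  moreover have "hausdorff_premeasure s (T u / 2) K \<le> hausdorff_measure s K"
    unfolding hausdorff_measure_def using T_pos[of u] by (intro SUP_upper) auto
  ultimately have "hausdorff_premeasure s (T u / 2) K = 0"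
    by simp
  \<comment> \<open>The words will weigh at most 2 \<open>\<eta>\<close> from the cover plus 2
    \<open>\<eta>\<close> from the errors, half the weight of \<open>u\<close> in all.\<close>
  define \<eta> :: real where "\<eta> = (1/2) ^ length u / 8"
  have "\<eta> > 0"
    by (simp add: \<eta>_def)
  then have "hausdorff_premeasure s (T u / 2) K < ennreal \<eta>"
    using \<open>hausdorff_premeasure s (T u / 2) K = 0\<close> by simp
  then obtain U where U: "K \<subseteq> (\<Union>i. U i)"
      "\<And>i. bounded (U i)" "\<And>i. diameter (U i) \<le> T u / 2"
      "(\<Sum>i. ennreal (diameter (U i) powr s)) < ennreal \<eta>"
    unfolding hausdorff_premeasure_def Inf_less_iff by blast
  have "\<exists>w. (1/2) ^ length w \<le> 2 * diameter (U i) powr s + 2 * \<eta> * (1/2) ^ Suc i \<and>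
    (\<forall>\<sigma>. pre \<sigma> (length u) = u \<and> Z \<sigma> \<in> U i \<longrightarrow> pre \<sigma> (length w) = w)" for i
    using U(3)[of i] T_pos[of u] \<open>\<eta> > 0\<close>
    by (intro ex_node_containing[OF assms U(2)]) auto
  then obtain w where w: "\<And>i. (1/2) ^ length (w i) \<le> 2 * diameter (U i) powr s + 2 * \<eta> * (1/2) ^ Suc i"
    "\<And>i \<sigma>. pre \<sigma> (length u) = u \<Longrightarrow> Z \<sigma> \<in> U i \<Longrightarrow> pre \<sigma> (length (w i)) = w i"
    by metis
  have geom: "(\<Sum>i. ennreal (2 * \<eta> * (1/2) ^ Suc i)) = ennreal (2 * \<eta>)"
    using sums_mult[OF power_half_series, of "2 * \<eta>"] \<open>\<eta> > 0\<close>
    by (intro suminf_ennreal_eq) auto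
  have "(\<Sum>i. ennreal ((1/2) ^ length (w i)))
      \<le> (\<Sum>i. 2 * ennreal (diameter (U i) powr s) + ennreal (2 * \<eta> * (1/2) ^ Suc i))"
  proof (rule suminf_le)
    fix i
    have "ennreal ((1/2) ^ length (w i)) \<le> ennreal (2 * diameter (U i) powr s + 2 * \<eta> * (1/2) ^ Suc i)"
      using w(1) by (rule ennreal_leI)
    also have "\<dots> = 2 * ennreal (diameter (U i) powr s) + ennreal (2 * \<eta> * (1/2) ^ Suc i)"
      using \<open>\<eta> > 0\<close> by (simp add: ennreal_plus ennreal_mult)
    finally show "ennreal ((1/2) ^ length (w i)) \<le> \<dots>" .
  qed auto
  also have "\<dots> = 2 * (\<Sum>i. ennreal (diameter (U i) powr s)) + ennreal (2 * \<eta>)"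
    unfolding geom[symmetric] by (subst suminf_add[symmetric]) auto
  also have "\<dots> \<le> 2 * ennreal \<eta> + ennreal (2 * \<eta>)"
    using U(4) by (intro add_right_mono mult_left_mono) auto
  also have "\<dots> = ennreal (4 * \<eta>)"
    using \<open>\<eta> > 0\<close> by (simp add: ennreal_mult flip: distrib_right)
  also have "\<dots> < ennreal ((1/2) ^ length u)"
    by (intro ennreal_lessI) (auto simp: \<eta>_def)
  finally obtain \<sigma> where \<sigma>: "pre \<sigma> (length u) = u" "\<And>i. pre \<sigma> (length (w i)) \<noteq> w i"
    using ex_branch_avoiding by blast
  obtain i where "Z \<sigma> \<in> U i"
    using U(1) Z_in[of \<sigma>] by blast
  with w(2) \<sigma> show False
    by blast
qed

end

section \<open>Construction of the tree\<close>

text \<open>Compactness supplies a farthest point in each search ball, and the absence of isolated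
  points makes it differ from the centre, so all radii are positive.\<close>

lemma ex_branching_tree:
  assumes K: "compact K" "K \<noteq> {}"
    and dens: "\<And>x. x \<in> K \<Longrightarrow> 0 < lower_mean_density K x"
  shows "\<exists>X T. branching_tree K X T"
proof -
  have "\<exists>y. y \<in> K \<and> y \<noteq> x \<and> dist x y \<le> t / 4 \<and> (\<forall>z\<in>K. dist x z \<le> t / 4 \<longrightarrow> dist x z \<le> dist x y)"
    if xt: "x \<in> K" "0 < t" for x t
  proof -
    have "\<exists>y\<in>K \<inter> cball x (t / 4). \<forall>z\<in>K \<inter> cball x (t / 4). dist x z \<le> dist x y"
      using xt K by (intro continuous_attains_sup compact_Int_closed continuous_intros) auto
    then obtain y where y: "y \<in> K" "dist x y \<le> t / 4"
      "\<And>z. z \<in> K \<Longrightarrow> dist x z \<le> t / 4 \<Longrightarrow> dist x z \<le> dist x y"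
      by auto
    obtain z where z: "z \<in> K" "z \<noteq> x" "dist x z \<le> t / 4"
      using ex_other_point_near[OF K(1) xt(1) dens[OF xt(1)], of "t / 4"] xt(2) by auto
    have "y \<noteq> x"
      using y(3)[OF z(1,3)] z(2) by auto
    with y show ?thesis by blast
  qed
  then obtain Y where Y: "\<And>x t. x \<in> K \<Longrightarrow> 0 < t \<Longrightarrow> Y x t \<in> K \<and> Y x t \<noteq> x \<and> dist x (Y x t) \<le> t / 4"
    "\<And>x t z. x \<in> K \<Longrightarrow> 0 < t \<Longrightarrow> z \<in> K \<Longrightarrow> dist x z \<le> t / 4 \<Longrightarrow> dist x z \<le> dist x (Y x t)"
    by metis
  obtain x where x: "x \<in> K"
    using K by blast
  define D where "D = diameter K"
  have "D > 0"
  proof -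
    have "Y x 1 \<in> K" "Y x 1 \<noteq> x"
      using Y(1)[OF x, of 1] by auto
    then have "0 < dist x (Y x 1)" "dist x (Y x 1) \<le> D"
      using diameter_bounded_bound[OF compact_imp_bounded[OF K(1)] x] by (auto simp: D_def)
    then show ?thesis by linarith
  qed
  define node where "node = rec_list (x, D)
    (\<lambda>b w p. (if b then Y (fst p) (snd p) else fst p, dist (fst p) (Y (fst p) (snd p)) / 4))"
  have node: "node [] = (x, D)" "node (b # w) = (if b then Y (fst (node w)) (snd (node w)) else fst (node w),
      dist (fst (node w)) (Y (fst (node w)) (snd (node w))) / 4)" for b w
    by (simp_all add: node_def)
  have inv: "fst (node w) \<in> K \<and> 0 < snd (node w)" for w
    by (induction w) (use x \<open>D > 0\<close> Y(1) in \<open>auto simp: node, metis\<close>)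
  have "4 * dist (fst (node w)) (Y (fst (node w)) (snd (node w))) \<le> snd (node w)" for w
    using Y(1)[of "fst (node w)" "snd (node w)"] inv[of w] by simp
  then have "branching_tree K (\<lambda>w. fst (node w)) (\<lambda>w. snd (node w))"
    by unfold_locales (use K inv Y in \<open>auto simp: node D_def\<close>)
  then show ?thesis by blast
qed

section \<open>The dimension bound\<close>

text \<open>The sequence \<open>\<delta>\<close> allows for a density bound that depends on the point, as long as only
  countably many values are needed.\<close>

lemma hausdorff_dim_ge:
  fixes \<delta> :: "nat \<Rightarrow> real"
  assumes K: "compact K" "K \<noteq> {}"
    and \<delta>: "\<And>k. 0 < \<delta> k" "antimono \<delta>"
    and dens: "\<And>x. x \<in> K \<Longrightarrow> \<exists>k. ereal (\<delta> k) < lower_mean_density K x"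
  shows "\<exists>k. ereal (ln 2 / 136 * \<delta> k) \<le> hausdorff_dim K"
proof -
  have "0 < lower_mean_density K x" if "x \<in> K" for x
    using dens[OF that] \<delta>(1) by (metis ereal_less(2) less_trans)
  then obtain X T where "branching_tree K X T"
    using ex_branching_tree K by blast
  then interpret branching_tree K X T .
  obtain k u where ku: "\<And>w. suffix u w \<Longrightarrow> exp (- 136 * real (length w) / \<delta> k) \<le> T w"
    using ex_node_radius_ge[of \<delta>] \<delta> dens by blast
  have "ln 2 / 136 * \<delta> k \<le> s" if s: "0 < s" "hausdorff_measure s K = 0" for s
  proof (rule ccontr)
    assume "\<not> ?thesis"
    \<comment> \<open>The assumed \<open>s < ln 2 / 136 * \<delta> k\<close>, rearranged so that the
      exponential radius bound gives 2^-n <= radius^s.\<close>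
    then have less: "136 / \<delta> k * s \<le> ln 2"
      using \<delta>(1)[of k] by (simp add: field_simps)
    have "(1/2) ^ length w \<le> T w powr s" if "suffix u w" for w
    proof -
      have "(1/2) ^ length w = exp (- ln (2::real)) ^ length w"
        by (simp add: exp_minus inverse_eq_divide)
      also have "\<dots> = exp (- ln 2 * real (length w))"
        by (simp only: exp_of_nat2_mult)
      also have "\<dots> \<le> exp (- (136 / \<delta> k * s) * real (length w))"
        using less by (intro iffD2[OF exp_le_cancel_iff] mult_right_mono) auto
      also have "\<dots> = exp (- 136 * real (length w) / \<delta> k) powr s"
        by (simp add: exp_powr_real)
      also have "\<dots> \<le> T w powr s"
        using ku[OF that] s by (intro powr_mono2) auto
      finally show ?thesis .
    qed
    with hausdorff_measure_neq_0[OF s(1)] s(2) show False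
      by blast
  qed
  then have "ereal (ln 2 / 136 * \<delta> k) \<le> hausdorff_dim K"
    unfolding hausdorff_dim_def by (intro Inf_greatest) auto
  then show ?thesis by blast
qed

theorem theorem6:
  shows "\<exists>c::real. c > 0 \<and>
    (\<forall>d\<ge>1. \<forall>K. K \<subseteq> Rd d \<and> K \<noteq> {} \<and> compact K \<longrightarrow>
      ((\<forall>x\<in>K. lower_mean_density K x > 0) \<longrightarrow>
        hausdorff_dim K > 0 \<and>
        (\<forall>d\<^sub>0::real. d\<^sub>0 > 0 \<and> (\<forall>x\<in>K. lower_mean_density K x \<ge> ereal (d\<^sub>0\<^sup>2)) \<longrightarrow>
          hausdorff_dim K \<ge> ereal (c * d\<^sub>0\<^sup>2))))"
proof (intro exI[of _ "ln 2 / 272"] conjI allI impI; (elim conjE)?)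
  fix K :: "finseq set"
  assume K: "K \<noteq> {}" "compact K"
  {
    assume pos: "\<forall>x\<in>K. lower_mean_density K x > 0"
    \<comment> \<open>The values 1 / (k + 1) tend to 0, so every positive mean density exceeds one
      of them.\<close>
    have "\<exists>k. ereal (ln 2 / 136 * (1 / real (Suc k))) \<le> hausdorff_dim K"
    proof (rule hausdorff_dim_ge[OF K(2,1)])
      show "antimono (\<lambda>k. 1 / real (Suc k))"
        by (intro antimonoI divide_left_mono) auto
      fix x
      assume "x \<in> K"
      then obtain \<epsilon> where \<epsilon>: "0 < ereal \<epsilon>" "ereal \<epsilon> < lower_mean_density K x"
        using pos ereal_dense2 by blast
      then obtain k where "1 / real (Suc k) < \<epsilon>"
        using nat_approx_posE[of \<epsilon>] by auto
      then show "\<exists>k. ereal (1 / real (Suc k)) < lower_mean_density K x"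
        using \<epsilon>(2) by (meson ereal_less_eq(3) le_less_trans less_imp_le)
    qed auto
    then show "hausdorff_dim K > 0"
      by (force intro: less_le_trans[rotated])
  }
  fix d\<^sub>0 :: real
  assume d0: "0 < d\<^sub>0" "\<forall>x\<in>K. ereal (d\<^sub>0\<^sup>2) \<le> lower_mean_density K x"
  \<comment> \<open>Halving \<open>d\<^sub>0\<^sup>2\<close> turns the weak inequality into a strict
    one, hence 272 = 2 * 136. The sequence is constant here.\<close>
  have "\<exists>k::nat. ereal (ln 2 / 136 * (d\<^sub>0\<^sup>2 / 2)) \<le> hausdorff_dim K"
  proof (rule hausdorff_dim_ge[OF K(2,1)])
    fix x
    assume "x \<in> K"
    with d0 have "ereal (d\<^sub>0\<^sup>2 / 2) < ereal (d\<^sub>0\<^sup>2)" "ereal (d\<^sub>0\<^sup>2) \<le> lower_mean_density K x"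
      by auto
    then show "\<exists>k::nat. ereal (d\<^sub>0\<^sup>2 / 2) < lower_mean_density K x"
      by (blast intro: less_le_trans)
  qed (use d0 in \<open>auto intro: antimonoI\<close>)
  then show "ereal (ln 2 / 272 * d\<^sub>0\<^sup>2) \<le> hausdorff_dim K"
    by (simp add: field_simps)
qed simp

end
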